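(* Let $f:\mathbb{R}^2\to\mathbb{R}$ and $g_i:\mathbb{R}^2\to\mathbb{R}$, $i=1,\dots,m$, be convex functions. Let $B\in\mathbb{N}$ and let $x\in[-B,B]^2$ (a real point) be such that $g_i(x)\le 0$ for all $i=1,\dots,m$. Then, in a number of evaluations of $f$ and $g_1,\dots,g_m$ that is polynomial in $\ln(B)$, one can either (a) find a point $\hat x\in[-B,B]^2\cap\mathbb{Z}^2$ with $f(\hat x)\le f(x)$ and $g_i(\hat x)\le 0$ for all $i=1,\dots,m$, or (b) show that there is no such point.
   Context: The functions are accessed through evaluations: an evaluation of a function at a point returns its value at that point. The statement asserts the existence of an algorithm which, given $B$, $x$ and access to $f,g_1,\dots,g_m$ by evaluations, correctly ends in outcome (a) or (b) within the stated number of evaluations. *)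

theory Defs
  imports "HOL-Analysis.Analysis" "HOL-Computational_Algebra.Polynomial"
begin

type_synonym point = "real ^ 2"

datatype func = Objective | Constraint nat

text \<open>
  Deterministic adaptive algorithms with access to functions by evaluation. In
  \<open>Evaluate q y k\<close> the value of the function named \<open>q\<close> at the point \<open>y\<close> is requested and
  the computation continues with \<open>k v\<close>, where \<open>v\<close> is that value: nothing else about the functions
  is accessible. Computation between evaluations is not charged. \<open>Return (Some y)\<close> outputs the
  point \<open>y\<close>; \<open>Return None\<close> claims that no point with the required properties exists.
\<close>

datatype algorithm =
    Return "point option"
  | Evaluate func point "real \<Rightarrow> algorithm"

fun interp :: "(point \<Rightarrow> real) \<Rightarrow> (nat \<Rightarrow> point \<Rightarrow> real) \<Rightarrow> func \<Rightarrow> point \<Rightarrow> real" where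
  "interp f g Objective = f"
| "interp f g (Constraint i) = g i"

primrec result :: "(func \<Rightarrow> point \<Rightarrow> real) \<Rightarrow> algorithm \<Rightarrow> point option" where
  "result h (Return r) = r"
| "result h (Evaluate q y k) = result h (k (h q y))"

text \<open>The functions evaluated during the run on \<open>h\<close>, one list entry per evaluation.\<close>

primrec evaluations :: "(func \<Rightarrow> point \<Rightarrow> real) \<Rightarrow> algorithm \<Rightarrow> func list" where
  "evaluations h (Return r) = []"
| "evaluations h (Evaluate q y k) = q # evaluations h (k (h q y))"

definition square :: "nat \<Rightarrow> point set" where
  "square B = {y. \<forall>j. y $ j \<in> {- real B .. real B}}"

definition integer_points :: "point set" where
  "integer_points = {y. \<forall>j. y $ j \<in> \<int>}"

definition improving_points ::
  "nat \<Rightarrow> (point \<Rightarrow> real) \<Rightarrow> (nat \<Rightarrow> point \<Rightarrow> real) \<Rightarrow> nat \<Rightarrow> point \<Rightarrow> point set" where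
  "improving_points m f g B x =
     {y \<in> square B \<inter> integer_points. f y \<le> f x \<and> (\<forall>i\<in>{1..m}. g i y \<le> 0)}"

end

theory Submission imports Defs begin

text \<open>
  Put \<open>h = max (f - f x) (g\<^sub>1, \<dots>, g\<^sub>m)\<close>. This function is convex, \<open>h x \<le> 0\<close>, and the points sought
  are the integer points of the square at which \<open>h \<le> 0\<close>. One value of \<open>h\<close> costs one evaluation of
  each given function, so it suffices to count the values of \<open>h\<close> that are needed. The square
  contains \<open>(2 B + 1)\<^sup>2\<close> integer points.

  Keep a finite set \<open>S\<close> of integer points that contains all solutions and arises from the square by
  cutting with half-planes. By a discrete centerpoint theorem (\<open>lattice_centerpoint\<close>) there is
  \<open>z \<in> S\<close> such that every closed half-plane containing \<open>z\<close> contains at least a quarter of \<open>S\<close>. If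
  \<open>h z \<le> 0\<close>, then \<open>z\<close> is an answer. If \<open>h z > 0\<close>, some open half-plane with \<open>z\<close> on its boundary
  contains all solutions, and passing to it removes a quarter of \<open>S\<close>. After \<open>O(ln B)\<close> such phases
  \<open>S\<close> is empty or a solution has been found. Because \<open>z\<close> is always an integer point, a
  nonpositive value ends the search; centerpoints in the plane would lack this property.

  It remains to find the half-plane, a subgradient being unavailable: only values are. The point
  \<open>x\<close> helps here. The boundary lines of the candidate half-planes pass through \<open>z\<close> and
  leave \<open>x\<close> on the inner side, so they form a one-parameter family. A solution \<open>w\<close> that lies beyond
  such a line is joined to \<open>x\<close> by a segment on which \<open>h \<le> 0\<close>, and this segment meets the line.
  Only finitely many crossing points can occur, because \<open>S\<close> is finite; hence one value of \<open>h\<close>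
  on the line, closer to \<open>z\<close> than all of them on its side, shows on which side of \<open>z\<close> they cannot
  lie. What it excludes depends monotonically on the slope of the line, and bisection over the
  \<open>O(B\<^sup>2)\<close> slopes that are relevant for \<open>S\<close> finds the cut with \<open>O(ln B)\<close> values
  (\<open>solvable_by_halfplane_cut\<close>). Altogether \<open>O((ln B + 1)\<^sup>2)\<close> evaluations of each function suffice.
\<close>

section \<open>Query complexity of a class of functions\<close>

definition correct_answer :: "'a set \<Rightarrow> ('a \<Rightarrow> real) \<Rightarrow> 'a option \<Rightarrow> bool" where
  "correct_answer P h r \<longleftrightarrow>
     (case r of Some y \<Rightarrow> y \<in> P \<and> h y \<le> 0 | None \<Rightarrow> \<forall>y\<in>P. \<not> h y \<le> 0)"

text \<open>
  The set \<open>H\<close> records what is known about the function: it is one of the members of \<open>H\<close>. A query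
  splits \<open>H\<close> according to the answer, and a result may be returned once it is correct for all
  remaining functions. Speaking of sets of possible functions instead of decision trees removes all
  bookkeeping of observed values from the complexity bounds; \<open>algorithm_of_solvable\<close> recovers the
  trees.
\<close>
inductive solvable :: "'a set \<Rightarrow> ('a \<Rightarrow> real) set \<Rightarrow> nat \<Rightarrow> bool" for P where
  answer: "\<forall>h\<in>H. correct_answer P h r \<Longrightarrow> solvable P H n"
| query: "(\<And>v. solvable P {h\<in>H. h y = v} n) \<Longrightarrow> solvable P H (Suc n)"

lemma solvable_subset: "solvable P H n \<Longrightarrow> H' \<subseteq> H \<Longrightarrow> solvable P H' n"
proof (induction arbitrary: H' rule: solvable.induct)
  case (answer H r n)
  then have "\<forall>h\<in>H'. correct_answer P h r" by blast
  then show ?case by (rule solvable.answer)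
next
  case (query H y n)
  have "solvable P {h\<in>H'. h y = v} n" for v
    by (rule query.IH[of _ v]) (use query.prems in blast)
  then show ?case by (rule solvable.query)
qed

lemma solvable_mono: "solvable P H n \<Longrightarrow> n \<le> n' \<Longrightarrow> solvable P H n'"
proof (induction arbitrary: n' rule: solvable.induct)
  case (answer H r n)
  from answer.hyps show ?case by (rule solvable.answer)
next
  case (query H y n)
  then obtain k where k: "n' = Suc k" "n \<le> k" by (cases n') auto
  have "solvable P {h\<in>H. h y = v} k" for v
    by (rule query.IH[OF k(2)])
  then show ?case unfolding k(1) by (rule solvable.query)
qed

lemma solvable_threshold:
  assumes "solvable P {h\<in>H. \<tau> \<le> h y} n" "solvable P {h\<in>H. h y < \<tau>} n"
  shows "solvable P H (Suc n)"
proof (rule solvable.query)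
  fix v
  show "solvable P {h\<in>H. h y = v} n"
  proof (cases "\<tau> \<le> v")
    case True
    then show ?thesis by (intro solvable_subset[OF assms(1)] subsetI) auto
  next
    case False
    then show ?thesis by (intro solvable_subset[OF assms(2)] subsetI) auto
  qed
qed

lemma exists_halving_element:
  fixes X :: "'a :: linorder set"
  assumes "finite X" "X \<noteq> {}" "card X < 2 * N" 
  obtains t where "t \<in> X" "card {x\<in>X. x < t} < N" "card {x\<in>X. t < x} < N"
proof -
  have N: "0 < N" using assms(3) by simp
  \<comment> \<open>The largest element with fewer than \<open>N\<close> predecessors is a median: its successor has at least
    \<open>N\<close> predecessors, which leaves fewer than \<open>N\<close> elements above.\<close>
  define Y where "Y = {t\<in>X. card {x\<in>X. x < t} < N}"
  have "\<not> x < Min X" if "x \<in> X" for x using Min_le[OF assms(1) that] by simp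
  then have "{x\<in>X. x < Min X} = {}" by blast
  then have "card {x\<in>X. x < Min X} < N" using N by (metis card.empty)
  then have "Min X \<in> Y" using assms unfolding Y_def by simp
  moreover have "finite Y" using assms(1) by (simp add: Y_def)
  moreover define t where "t = Max Y"
  ultimately have t: "t \<in> Y" "\<And>s. s \<in> Y \<Longrightarrow> s \<le> t" by (auto intro: Max_in)
  have "card {x\<in>X. t < x} < N"
  proof (cases "{x\<in>X. t < x} = {}")
    case True
    then show ?thesis using N by (metis card.empty)
  next
    case False
    define t' where "t' = Min {x\<in>X. t < x}"
    have fin: "finite {x\<in>X. t < x}" using assms(1) by simp
    have t': "t' \<in> X" "t < t'" using Min_in[OF fin False] by (auto simp: t'_def)
    have least: "\<And>x. x \<in> X \<Longrightarrow> t < x \<Longrightarrow> t' \<le> x"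
      using fin by (simp add: t'_def)
    have "t' \<notin> Y" using t(2)[of t'] t'(2) by (meson leD)
    then have "N \<le> card {x\<in>X. x < t'}" using t'(1) by (simp add: Y_def)
    moreover have "card {x\<in>X. x < t'} + card {x\<in>X. t < x} = card X"
    proof -
      have "x < t' \<longleftrightarrow> \<not> t < x" if "x \<in> X" for x
        using least[OF that] t'(2) by (meson leD le_less_trans not_le)
      then have "{x\<in>X. x < t'} \<union> {x\<in>X. t < x} = X" "{x\<in>X. x < t'} \<inter> {x\<in>X. t < x} = {}"
        by auto
      then show ?thesis using assms(1) by (metis card_Un_disjoint finite_Un)
    qed
    ultimately show ?thesis using assms(3) by linarith
  qed
  then show thesis using that[of t] t(1) by (simp add: Y_def)
qed

text \<open>
  Bisection with a two-sided test. The properties \<open>A\<close> and \<open>B\<close> may both hold at \<open>t\<close>, and one query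
  establishes one of them, so the invariant is only \<open>A\<close> at the left end and \<open>B\<close> at the right end.
  The search stops when no critical value is strictly between the ends; the ends themselves may be
  critical.
\<close>
lemma solvable_by_bisection:
  fixes T :: "real set" and A B :: "('a \<Rightarrow> real) \<Rightarrow> real \<Rightarrow> bool"
  assumes "finite T" "card (T \<inter> {l<..<r}) < 2 ^ k" "l < r"
    and "\<And>h. h \<in> H \<Longrightarrow> A h l \<and> B h r"
    and "\<And>t. t \<in> T \<Longrightarrow> \<exists>y \<tau>. \<forall>h\<in>H. if \<tau> \<le> h y then A h t else B h t"
    and "\<And>H' l r. H' \<subseteq> H \<Longrightarrow> l < r \<Longrightarrow> T \<inter> {l<..<r} = {} \<Longrightarrow> 
           (\<And>h. h \<in> H' \<Longrightarrow> A h l \<and> B h r) \<Longrightarrow> solvable P H' n"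
  shows "solvable P H (k + n)"
  using assms(2-)
proof (induction k arbitrary: H l r)
  case 0
  then have "T \<inter> {l<..<r} = {}" using assms(1) by simp
  then have "solvable P H n" using 0 by (intro 0(5)[OF order_refl 0(2)]) auto
  then show ?case by simp
next
  case (Suc k)
  show ?case
  proof (cases "T \<inter> {l<..<r} = {}")
    case True
    then have "solvable P H n" 
      using Suc.prems(3) by (intro Suc.prems(5)[OF order_refl Suc.prems(2)]) auto
    then show ?thesis by (rule solvable_mono) simp
  next
    case False
    have "finite (T \<inter> {l<..<r})" "card (T \<inter> {l<..<r}) < 2 * 2 ^ k"
      using assms(1) Suc.prems(1) by auto
    then obtain t where t: "t \<in> T \<inter> {l<..<r}" 
      "card {x \<in> T \<inter> {l<..<r}. x < t} < 2 ^ k" "card {x \<in> T \<inter> {l<..<r}. t < x} < 2 ^ k"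
      by (rule exists_halving_element[OF _ False])
    obtain y \<tau> where y: "\<And>h. h \<in> H \<Longrightarrow> if \<tau> \<le> h y then A h t else B h t"
      using Suc.prems(4)[of t] t(1) by blast
    have eq: "{x \<in> T \<inter> {l<..<r}. x < t} = T \<inter> {l<..<t}"
      "{x \<in> T \<inter> {l<..<r}. t < x} = T \<inter> {t<..<r}" using t(1) by auto
    have test: "\<exists>y \<tau>. \<forall>h\<in>H'. if \<tau> \<le> h y then A h s else B h s" 
      if "H' \<subseteq> H" "s \<in> T" for H' s using Suc.prems(4)[OF that(2)] that(1) by (meson subsetD)
    have "solvable P {h\<in>H. \<tau> \<le> h y} (k + n)"
    proof (rule Suc.IH[of t r])
      show "card (T \<inter> {t<..<r}) < 2 ^ k" using t(3) unfolding eq .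
      show "t < r" using t(1) by simp
      show "\<exists>y' \<tau>'. \<forall>h\<in>{h\<in>H. \<tau> \<le> h y}. if \<tau>' \<le> h y' then A h s else B h s" if "s \<in> T" for s
        by (rule test[OF _ that]) blast
      show "A h t \<and> B h r" if "h \<in> {h\<in>H. \<tau> \<le> h y}" for h
        using y[of h] Suc.prems(3)[of h] that by simp
      show "solvable P H' n" if "H' \<subseteq> {h\<in>H. \<tau> \<le> h y}" "l < r" "T \<inter> {l<..<r} = {}"
        "\<And>h. h \<in> H' \<Longrightarrow> A h l \<and> B h r" for H' l r
        by (rule Suc.prems(5)[OF _ that(2,3,4)]) (use that(1) in auto)
    qed
    moreover have "solvable P {h\<in>H. h y < \<tau>} (k + n)"
    proof (rule Suc.IH[of l t])
      show "card (T \<inter> {l<..<t}) < 2 ^ k" using t(2) unfolding eq .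
      show "l < t" using t(1) by simp
      show "\<exists>y' \<tau>'. \<forall>h\<in>{h\<in>H. h y < \<tau>}. if \<tau>' \<le> h y' then A h s else B h s" if "s \<in> T" for s
        by (rule test[OF _ that]) blast
      show "A h l \<and> B h t" if "h \<in> {h\<in>H. h y < \<tau>}" for h
        using y[of h] Suc.prems(3)[of h] that by simp
      show "solvable P H' n" if "H' \<subseteq> {h\<in>H. h y < \<tau>}" "l < r" "T \<inter> {l<..<r} = {}"
        "\<And>h. h \<in> H' \<Longrightarrow> A h l \<and> B h r" for H' l r
        by (rule Suc.prems(5)[OF _ that(2,3,4)]) (use that(1) in auto)
    qed
    ultimately have "solvable P H (Suc (k + n))" by (rule solvable_threshold)
    then show ?thesis by simp
  qed
qed

section \<open>Lattice centerpoints\<close>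

definition lattice :: "(real ^ 'n) set" where
  "lattice = {y. \<forall>j. y $ j \<in> \<int>}"

text \<open>The lattice points of a convex set have this property, and cutting with a half-space preserves it.
  It is what the parity argument below uses of convexity.\<close>
definition midpoint_closed :: "(real ^ 'n) set \<Rightarrow> bool" where
  "midpoint_closed S \<longleftrightarrow> (\<forall>a\<in>S. \<forall>b\<in>S. midpoint a b \<in> lattice \<longrightarrow> midpoint a b \<in> S)"

lemma inner_midpoint: "s \<bullet> midpoint a b = (s \<bullet> a + s \<bullet> b) / 2"
  by (simp add: midpoint_def inner_right_distrib)

lemma midpoint_closed_halfspace:
  assumes "midpoint_closed S" shows "midpoint_closed {w\<in>S. s \<bullet> w < c}"
  using assms by (auto simp: midpoint_closed_def inner_midpoint)

lemma parity_pigeonhole: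
  fixes a :: "'b \<Rightarrow> real ^ 'n"
  assumes "finite J" "2 ^ CARD('n) < card J" "\<And>p. p \<in> J \<Longrightarrow> a p \<in> lattice"
  obtains p q where "p \<in> J" "q \<in> J" "p \<noteq> q" "midpoint (a p) (a q) \<in> lattice"
proof -
  define par where "par p = {j. even \<lfloor>a p $ j\<rfloor>}" for p
  have "card (par ` J) \<le> card (UNIV :: 'n set set)" by (intro card_mono) auto
  also have "\<dots> = 2 ^ CARD('n)" by (simp add: card_UNIV_set)
  finally have "\<not> inj_on par J" using assms(2) by (auto dest: card_image)
  then obtain p q where pq: "p \<in> J" "q \<in> J" "p \<noteq> q" "par p = par q" 
    by (auto simp: inj_on_def)
  have "midpoint (a p) (a q) $ j \<in> \<int>" for j
  proof -
    have "a p $ j \<in> \<int>" "a q $ j \<in> \<int>"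
      using assms(3)[OF pq(1)] assms(3)[OF pq(2)] by (auto simp: lattice_def)
    then obtain m n where mn: "a p $ j = of_int m" "a q $ j = of_int n"
      by (auto elim!: Ints_cases)
    have "j \<in> par p \<longleftrightarrow> j \<in> par q" using pq(4) by simp
    then have "even m \<longleftrightarrow> even n" by (simp add: par_def mn)
    then obtain k where "m + n = 2 * k" by (metis even_add evenE)
    then have "real_of_int m + real_of_int n = 2 * real_of_int k" by (metis of_int_add of_int_mult of_int_numeral)
    then have "midpoint (a p) (a q) $ j = of_int k"
      by (simp add: midpoint_def mn)
    then show ?thesis by simp
  qed
  then show thesis using that[OF pq(1-3)] by (simp add: lattice_def)
qed

text \<open>
  This is the argument behind Doignon's theorem that the lattice \<open>\<int>\<^sup>n\<close> has Helly number \<open>2\<^sup>n\<close>,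
  stated for coverings by complements. In a covering of \<open>S\<close> by closed half-spaces of smallest total
  size, every member \<open>p\<close> has a point \<open>a p\<close> of \<open>S\<close> that no other member covers, and by minimality
  the boundary of \<open>p\<close> may be taken through \<open>a p\<close>. If there were more than \<open>2\<^sup>n\<close> members, then two of
  the points \<open>a p\<close> would agree modulo 2. Their midpoint is in \<open>S\<close> but in no member of the covering:
  it is an average of points outside or on the boundary of each member, not both on the boundary.
  So at most \<open>2\<^sup>n\<close> members occur, which is impossible if each covers less than \<open>card S / 2\<^sup>n\<close> points.
\<close>
lemma no_cover_by_light_halfspaces:
  fixes S :: "(real ^ 'n) set" and J :: "((real ^ 'n) \<times> real) set"
  defines "out p \<equiv> {w\<in>S. snd p \<le> fst p \<bullet> w}"
  assumes S: "finite S" "S \<noteq> {}" "S \<subseteq> lattice" "midpoint_closed S"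
    and J: "finite J" "\<And>p. p \<in> J \<Longrightarrow> 2 ^ CARD('n) * card (out p) < card S"
  shows "\<not> S \<subseteq> (\<Union>p\<in>J. out p)"
proof
  let ?N = "2 ^ CARD('n) :: nat"
  define cover where "cover J \<longleftrightarrow> finite J \<and> (\<forall>p\<in>J. ?N * card (out p) < card S)
    \<and> S \<subseteq> (\<Union>p\<in>J. out p)" for J
  \<comment> \<open>The summand \<open>Suc\<close> makes dropping a member decrease the size even if its trace on \<open>S\<close> is empty.\<close>
  define size where "size J = (\<Sum>p\<in>J. Suc (card (out p)))" for J
  have fin: "finite (out p)" for p using S(1) by (simp add: out_def)
  assume "S \<subseteq> (\<Union>p\<in>J. out p)"
  with J have "cover J" by (auto simp: cover_def)
  then obtain J where J: "cover J" and least: "\<And>J'. cover J' \<Longrightarrow> size J \<le> size J'"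
    using ex_has_least_nat[of cover J size] by auto
  have finJ: "finite J" using J by (simp add: cover_def)
  have remove: "size J = Suc (card (out p)) + size (J - {p})" if "p \<in> J" for p
    using finJ that by (simp add: size_def sum.remove)
  have "\<exists>a. a \<in> S \<and> (\<forall>q\<in>J - {p}. a \<notin> out q) \<and> a \<in> out p \<and> 
      (\<forall>w\<in>S. fst p \<bullet> a \<le> fst p \<bullet> w \<longleftrightarrow> w \<in> out p)" if p: "p \<in> J" for p
  proof -
    let ?R = "S - (\<Union>q\<in>J - {p}. out q)"
    have "\<not> cover (J - {p})" using least[of "J - {p}"] remove[OF p] by auto
    then have "?R \<noteq> {}" using J by (auto simp: cover_def)
    moreover have "finite ?R" using S(1) by simp
    ultimately obtain a where a: "a \<in> ?R" "\<And>w. w \<in> ?R \<Longrightarrow> fst p \<bullet> a \<le> fst p \<bullet> w"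
      using ex_min_if_finite[of "(\<lambda>w. fst p \<bullet> w) ` ?R"] by (force simp: not_less)
    have ap: "a \<in> out p" using a(1) J by (auto simp: cover_def)
    \<comment> \<open>Shrink \<open>p\<close> until its boundary touches the nearest point that only \<open>p\<close> covers; the result is
      still a covering, so by minimality the trace on \<open>S\<close> has not changed.\<close>
    define p' where "p' = (fst p, fst p \<bullet> a)"
    define J' where "J' = insert p' (J - {p})"
    have sub: "out p' \<subseteq> out p" using ap by (auto simp: out_def p'_def)
    have "?N * card (out p') \<le> ?N * card (out p)"
      using card_mono[OF fin sub] by simp
    moreover have "?N * card (out p) < card S" using J p by (simp add: cover_def)
    ultimately have "?N * card (out p') < card S" by (rule le_less_trans)
    moreover have "S \<subseteq> (\<Union>q\<in>J'. out q)"
      using a(2) by (auto simp: J'_def p'_def out_def)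
    ultimately have "cover J'" using J by (auto simp: cover_def J'_def)
    then have "size J \<le> size J'" by (rule least)
    also have "size J' \<le> Suc (card (out p')) + size (J - {p})"
      using finJ by (cases "p' \<in> J - {p}") (simp_all add: J'_def size_def insert_absorb)
    finally have "card (out p) \<le> card (out p')" using remove[OF p] by simp
    then have "out p' = out p" by (intro card_seteq fin sub)
    then have "\<forall>w\<in>S. fst p \<bullet> a \<le> fst p \<bullet> w \<longleftrightarrow> w \<in> out p"
      by (auto simp: out_def p'_def)
    with a(1) ap show ?thesis by blast
  qed
  then have "\<forall>p\<in>J. \<exists>a. a \<in> S \<and> (\<forall>q\<in>J - {p}. a \<notin> out q) \<and> a \<in> out p \<and> 
      (\<forall>w\<in>S. fst p \<bullet> a \<le> fst p \<bullet> w \<longleftrightarrow> w \<in> out p)" by blast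
  then obtain a where a': "\<forall>p\<in>J. a p \<in> S \<and> (\<forall>q\<in>J - {p}. a p \<notin> out q) \<and> a p \<in> out p \<and> 
      (\<forall>w\<in>S. fst p \<bullet> a p \<le> fst p \<bullet> w \<longleftrightarrow> w \<in> out p)"
    by (rule bchoice[THEN exE])
  have a: "a p \<in> S" "a p \<in> out p" if "p \<in> J" for p using a' that by auto
  have alone: "a p \<notin> out q" if "p \<in> J" "q \<in> J" "p \<noteq> q" for p q using a' that by auto
  have tight: "fst p \<bullet> a p \<le> fst p \<bullet> w \<longleftrightarrow> w \<in> out p" if "p \<in> J" "w \<in> S" for p w 
    using a' that by auto
  have "card J \<le> ?N"
  proof (rule ccontr)
    assume "\<not> card J \<le> ?N"
    then have many: "?N < card J" by simp
    have "a p \<in> lattice" if "p \<in> J" for p using a(1)[OF that] S(3) by blast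
    then obtain p q where pq: "p \<in> J" "q \<in> J" "p \<noteq> q" and m: "midpoint (a p) (a q) \<in> lattice"
      using parity_pigeonhole[OF finJ many] by blast
    have mS: "midpoint (a p) (a q) \<in> S" 
      using S(4) a(1) pq m by (auto simp: midpoint_closed_def)
    then obtain c where c: "c \<in> J" "midpoint (a p) (a q) \<in> out c"
      using J by (auto simp: cover_def)
    have lt: "fst c \<bullet> a d < fst c \<bullet> a c" if "d \<in> J" "d \<noteq> c" for d
      using alone[of d c] tight[of c "a d"] a(1)[of d] that c(1) by (simp add: not_le)
    have le: "fst c \<bullet> a c \<le> (fst c \<bullet> a p + fst c \<bullet> a q) / 2"
      using tight[OF c(1) mS] c(2) by (simp add: inner_midpoint)
    show False
      using lt[of p] lt[of q] le pq by (cases "p = c"; cases "q = c") auto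
  qed
  have "card S \<le> card (\<Union>p\<in>J. out p)"
    using J finJ fin by (intro card_mono) (auto simp: cover_def)
  also have "\<dots> \<le> (\<Sum>p\<in>J. card (out p))" by (rule card_UN_le[OF finJ])
  finally have "?N * card S \<le> (\<Sum>p\<in>J. ?N * card (out p))"
    by (simp flip: sum_distrib_left)
  also have "\<dots> < (\<Sum>p\<in>J. card S)"
    using J finJ S(2) by (intro sum_strict_mono) (auto simp: cover_def)
  also have "\<dots> \<le> ?N * card S" using \<open>card J \<le> ?N\<close> by simp
  finally show False by simp
qed

text \<open>If no point were this deep, the light half-spaces witnessing that, one for each point of \<open>S\<close>,
  would cover \<open>S\<close>.\<close>
theorem lattice_centerpoint:
  fixes S :: "(real ^ 'n) set"
  assumes S: "finite S" "S \<noteq> {}" "S \<subseteq> lattice" "midpoint_closed S"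
  obtains z where "z \<in> S" "\<And>s. card S \<le> 2 ^ CARD('n) * card {w\<in>S. s \<bullet> z \<le> s \<bullet> w}"
proof (rule ccontr)
  assume "\<not> thesis"
  then have "\<forall>z\<in>S. \<exists>s. 2 ^ CARD('n) * card {w\<in>S. s \<bullet> z \<le> s \<bullet> w} < card S"
    using that by (meson not_le)
  then obtain s where s: "\<And>z. z \<in> S \<Longrightarrow> 2 ^ CARD('n) * card {w\<in>S. s z \<bullet> z \<le> s z \<bullet> w} < card S"
    by metis
  have "\<not> S \<subseteq> (\<Union>p\<in>(\<lambda>z. (s z, s z \<bullet> z)) ` S. {w\<in>S. snd p \<le> fst p \<bullet> w})"
    by (rule no_cover_by_light_halfspaces[OF S]) (use s S(1) in auto)
  then show False by force
qed

section \<open>Half-plane cuts from function values\<close>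

definition quarter_turn :: "point \<Rightarrow> point" where
  "quarter_turn u = vector [- u $ 2, u $ 1]"

text \<open>
  For a slope parameter \<open>t\<close>, the line through \<open>z\<close> with normal vector \<open>u + t *\<^sub>R v\<close> has the direction
  \<open>v - t *\<^sub>R u\<close>, because \<open>u\<close> and \<open>v\<close> are orthogonal and of equal length. Every line through \<open>z\<close>
  that misses \<open>x\<close> is of this form, and \<open>x\<close> is on its negative side. If \<open>w\<close> is on the
  nonnegative side, this locates the point where the segment from \<open>x\<close> to \<open>w\<close> crosses the line; the
  sign of \<open>b\<close> tells on which side of \<open>z\<close>.
\<close>
lemma point_on_segment_and_line:
  fixes x z w :: point
  defines "u \<equiv> z - x"
  defines "v \<equiv> quarter_turn u"
  defines "a \<equiv> u \<bullet> (w - z)" and "b \<equiv> v \<bullet> (w - z)"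
  assumes "x \<noteq> z" "0 \<le> a + t * b"
  shows "z + (b / (u \<bullet> u + (a + t * b))) *\<^sub>R (v - t *\<^sub>R u) \<in> closed_segment x w"
proof -
  define \<mu> where "\<mu> = u \<bullet> u / (u \<bullet> u + (a + t * b))"
  have D: "0 < u \<bullet> u" using assms by simp
  then have pos: "0 < u \<bullet> u + (a + t * b)" using assms(6) by linarith
  have \<mu>: "0 \<le> \<mu>" "\<mu> \<le> 1" using D assms(6) pos by (auto simp: \<mu>_def divide_le_eq)
  have "(u \<bullet> u + (a + t * b)) *\<^sub>R (z - x) + b *\<^sub>R (v - t *\<^sub>R u) = (u \<bullet> u) *\<^sub>R (w - x)"
    unfolding vec_eq_iff forall_2 a_def b_def v_def u_def quarter_turn_def
    by (simp add: inner_vec_def sum_2 vector_2) algebra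
  then have "(1 / (u \<bullet> u + (a + t * b))) *\<^sub>R 
      ((u \<bullet> u + (a + t * b)) *\<^sub>R (z - x) + b *\<^sub>R (v - t *\<^sub>R u)) = \<mu> *\<^sub>R (w - x)"
    by (simp add: \<mu>_def)
  then have "(z - x) + (b / (u \<bullet> u + (a + t * b))) *\<^sub>R (v - t *\<^sub>R u) = \<mu> *\<^sub>R (w - x)"
    using pos by (simp add: scaleR_add_right)
  then have "z + (b / (u \<bullet> u + (a + t * b))) *\<^sub>R (v - t *\<^sub>R u) = (1 - \<mu>) *\<^sub>R x + \<mu> *\<^sub>R w"
    by (simp add: algebra_simps)
  then show ?thesis using \<mu> by (auto simp: in_segment)
qed

lemma convex_nonpos_segment:
  fixes h :: "'a :: real_vector \<Rightarrow> real"
  assumes "convex_on UNIV h" "h x \<le> 0" "h w \<le> 0" "y \<in> closed_segment x w"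
  shows "h y \<le> 0"
proof -
  obtain u where u: "0 \<le> u" "u \<le> 1" "y = (1 - u) *\<^sub>R x + u *\<^sub>R w"
    using assms(4) by (auto simp: in_segment)
  have "h y \<le> max (h x) (h w)"
    unfolding u(3) by (rule convex_lower[OF assms(1)]) (use u in auto)
  with assms(2,3) show ?thesis by simp
qed

text \<open>One value near \<open>z\<close> restricts where on a line through \<open>z\<close> a convex function can be nonpositive:
  on a ray from \<open>z\<close>, a value not below \<open>h z\<close> at distance \<open>\<epsilon>\<close> excludes everything from there on, and
  a value below \<open>h z\<close> excludes the opposite ray.\<close>
lemma convex_ray_test:
  fixes h :: "'a :: real_vector \<Rightarrow> real"
  assumes h: "convex_on UNIV h" "0 < h z" and \<epsilon>: "0 < \<epsilon>" and r: "h (z + r *\<^sub>R d) \<le> 0"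
  shows "h z \<le> h (z + \<epsilon> *\<^sub>R d) \<Longrightarrow> r < \<epsilon>"
    and "h (z + \<epsilon> *\<^sub>R d) < h z \<Longrightarrow> 0 < r"
proof -
  show "r < \<epsilon>" if "h z \<le> h (z + \<epsilon> *\<^sub>R d)"
  proof (rule ccontr)
    assume "\<not> r < \<epsilon>"
    \<comment> \<open>The test point lies between \<open>z\<close> and the point at \<open>r\<close>.\<close>
    define s where "s = \<epsilon> / r"
    have s: "0 < s" "s \<le> 1" "s * r = \<epsilon>" using \<epsilon> \<open>\<not> r < \<epsilon>\<close> by (auto simp: s_def)
    have eq: "z + \<epsilon> *\<^sub>R d = (1 - s) *\<^sub>R z + s *\<^sub>R (z + r *\<^sub>R d)"
      using s(3) by (simp add: algebra_simps)
    have "h (z + \<epsilon> *\<^sub>R d) \<le> (1 - s) * h z + s * h (z + r *\<^sub>R d)"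
      unfolding eq by (rule convex_onD[OF h(1)]) (use s in auto)
    also have "\<dots> \<le> (1 - s) * h z" using s r by (simp add: mult_nonneg_nonpos)
    also have "\<dots> < h z" using s h(2) by (simp add: algebra_simps)
    finally show False using that by simp
  qed
  show "0 < r" if "h (z + \<epsilon> *\<^sub>R d) < h z"
  proof (rule ccontr)
    assume "\<not> 0 < r"
    \<comment> \<open>Here \<open>z\<close> lies between the point at \<open>r\<close> and the test point.\<close>
    define s where "s = - r / (\<epsilon> - r)"
    have s: "0 \<le> s" "s \<le> 1" "s * (\<epsilon> - r) = - r" 
      using \<epsilon> \<open>\<not> 0 < r\<close> by (auto simp: s_def divide_simps)
    have "s *\<^sub>R \<epsilon> *\<^sub>R d + (1 - s) *\<^sub>R r *\<^sub>R d = (s * (\<epsilon> - r) + r) *\<^sub>R d"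
      by (simp add: algebra_simps)
    then have eq: "z = (1 - s) *\<^sub>R (z + r *\<^sub>R d) + s *\<^sub>R (z + \<epsilon> *\<^sub>R d)"
      unfolding s(3) by (simp add: algebra_simps)
    have "h z \<le> (1 - s) * h (z + r *\<^sub>R d) + s * h (z + \<epsilon> *\<^sub>R d)"
      by (subst eq, rule convex_onD[OF h(1)]) (use s in auto)
    also have "\<dots> \<le> s * h (z + \<epsilon> *\<^sub>R d)" using s r by (simp add: mult_nonneg_nonpos)
    also have "\<dots> < h z"
    proof (cases "0 < h (z + \<epsilon> *\<^sub>R d)")
      case True
      then have "s * h (z + \<epsilon> *\<^sub>R d) \<le> h (z + \<epsilon> *\<^sub>R d)" using s by (simp add: mult_left_le_one_le)
      with that show ?thesis by simp
    next
      case False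
      then have "s * h (z + \<epsilon> *\<^sub>R d) \<le> 0" using s by (simp add: mult_nonneg_nonpos)
      with h(2) show ?thesis by simp
    qed
    finally show False by simp
  qed
qed

lemma finite_positive_lower_bound:
  fixes F :: "real set"
  assumes "finite F" "\<And>y. y \<in> F \<Longrightarrow> 0 < y"
  obtains \<epsilon> where "0 < \<epsilon>" "\<And>y. y \<in> F \<Longrightarrow> \<epsilon> \<le> y"
  using assms that[of "Min (insert 1 F)"] by (auto simp: Min_gr_iff)

text \<open>
  Once \<open>h z\<close> is known to be positive, \<open>k\<close> further values yield a normal vector \<open>s\<close> of a half-plane
  that contains all solutions in \<open>S\<close> but not \<open>z\<close>. With \<open>s = u + t *\<^sub>R v\<close>, a solution \<open>w\<close> is on the
  correct side if \<open>a w + t * b w < 0\<close>. Let \<open>A h t\<close> and \<open>B h t\<close> say this for the solutions with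
  \<open>b w > 0\<close> and with \<open>b w < 0\<close>. The former excludes solutions that cross the line on the one side
  of \<open>z\<close>, the latter those that cross it on the other side, and \<open>convex_ray_test\<close> decides for one of
  them. Both can change only at the slopes \<open>- a w / b w\<close>: as \<open>t\<close> grows, \<open>A h\<close> can only be lost and
  \<open>B h\<close> only be gained. Bisection over these slopes ends with neighbours \<open>l < r\<close> such that \<open>A h l\<close>
  and \<open>B h r\<close>, and then both properties hold strictly between them.
\<close>
lemma solvable_by_halfplane_cut:
  fixes x z :: point
  assumes S: "finite S" "card S < 2 ^ k"
    and H: "\<And>h. h \<in> H \<Longrightarrow> convex_on UNIV h \<and> h x \<le> 0 \<and> h z = c" "0 < c"
    and after_cut: "\<And>H' s. H' \<subseteq> H \<Longrightarrow>
           (\<And>h w. h \<in> H' \<Longrightarrow> w \<in> S \<Longrightarrow> h w \<le> 0 \<Longrightarrow> s \<bullet> w < s \<bullet> z) \<Longrightarrow> solvable P H' n"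
  shows "solvable P H (k + n)"
proof (cases "x = z")
  case True
  then have "H = {}" using H by fastforce
  then have "solvable P H n" by (intro after_cut[of H 0]) auto
  then show ?thesis by (rule solvable_mono) simp
next
  case False
  define u where "u = z - x"
  define v where "v = quarter_turn u"
  define a where "a w = u \<bullet> (w - z)" for w
  define b where "b w = v \<bullet> (w - z)" for w
  define D where "D = u \<bullet> u"
  have D: "0 < D" using False by (simp add: D_def u_def)
  have crossing: "h (z + (b w / (D + (a w + t * b w))) *\<^sub>R (v - t *\<^sub>R u)) \<le> 0"
    if "h \<in> H" "h w \<le> 0" "0 \<le> a w + t * b w" for h w t
  proof (rule convex_nonpos_segment[of h x w])
    show "z + (b w / (D + (a w + t * b w))) *\<^sub>R (v - t *\<^sub>R u) \<in> closed_segment x w"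
      using that(3) unfolding a_def b_def v_def u_def D_def
      by (rule point_on_segment_and_line[OF False])
  qed (use H(1)[OF that(1)] that(2) in auto)
  define A where "A h t \<longleftrightarrow> (\<forall>w\<in>S. h w \<le> 0 \<longrightarrow> 0 < b w \<longrightarrow> a w + t * b w < 0)" 
    for h :: "point \<Rightarrow> real" and t
  define B where "B h t \<longleftrightarrow> (\<forall>w\<in>S. h w \<le> 0 \<longrightarrow> b w < 0 \<longrightarrow> a w + t * b w < 0)" 
    for h :: "point \<Rightarrow> real" and t
  define T where "T = (\<lambda>w. - a w / b w) ` {w\<in>S. b w \<noteq> 0}"
  have finT: "finite T" using S(1) by (simp add: T_def)
  have T: "- a w / b w \<in> T" if "w \<in> S" "b w \<noteq> 0" for w using that by (auto simp: T_def)
  have cardT: "card T < 2 ^ k"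
  proof -
    have "card T \<le> card {w\<in>S. b w \<noteq> 0}" unfolding T_def using S(1) by (intro card_image_le) simp
    also have "\<dots> \<le> card S" using S(1) by (intro card_mono) auto
    finally show ?thesis using S(2) by simp
  qed
  have pos: "a w + t * b w < 0 \<longleftrightarrow> t < - a w / b w" if "0 < b w" for w t
    unfolding pos_less_divide_eq[OF that] by linarith
  have neg: "a w + t * b w < 0 \<longleftrightarrow> - a w / b w < t" if "b w < 0" for w t
    unfolding neg_divide_less_eq[OF that] by linarith
  \<comment> \<open>Outside the range of the slopes one of \<open>A\<close> and \<open>B\<close> holds without a query.\<close>
  define l where "l = Min (insert 0 T) - 1"
  define r where "r = Max (insert 0 T) + 1"
  have lr: "l < t" "t < r" if "t \<in> insert 0 T" for t
  proof -
    have "Min (insert 0 T) \<le> t" "t \<le> Max (insert 0 T)"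
      by (rule Min_le Max_ge; use finT that in simp)+
    then show "l < t" "t < r" unfolding l_def r_def by linarith+
  qed
  show ?thesis
  proof (rule solvable_by_bisection[where T = T and l = l and r = r and A = A and B = B])
    show "finite T" by (rule finT)
    show "card (T \<inter> {l<..<r}) < 2 ^ k"
      using card_mono[OF finT, of "T \<inter> {l<..<r}"] cardT by simp
    show "l < r" using lr[of 0] by simp
    have "a w + l * b w < 0" if "w \<in> S" "0 < b w" for w
      using pos[OF that(2)] lr(1)[of "- a w / b w"] T[OF that(1)] that(2) by simp
    moreover have "a w + r * b w < 0" if "w \<in> S" "b w < 0" for w
      using neg[OF that(2)] lr(2)[of "- a w / b w"] T[OF that(1)] that(2) by simp
    ultimately show "A h l \<and> B h r" for h by (simp add: A_def B_def)
  next
    fix t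
    \<comment> \<open>The test point has to be at most as far from \<open>z\<close> as any possible crossing on its side.\<close>
    define F where "F = (\<lambda>w. b w / (D + (a w + t * b w))) ` {w\<in>S. 0 < b w \<and> 0 \<le> a w + t * b w}"
    have "finite F" using S(1) by (simp add: F_def)
    moreover have "0 < y" if "y \<in> F" for y using that D by (auto simp: F_def)
    ultimately obtain \<epsilon> where \<epsilon>: "0 < \<epsilon>" "\<And>y. y \<in> F \<Longrightarrow> \<epsilon> \<le> y"
      using finite_positive_lower_bound by metis
    have "if c \<le> h (z + \<epsilon> *\<^sub>R (v - t *\<^sub>R u)) then A h t else B h t" if h: "h \<in> H" for h
    proof -
      have hc: "convex_on UNIV h" "0 < h z" "h z = c" using H h by auto
      have "a w + t * b w < 0" if "w \<in> S" "h w \<le> 0" "0 < b w" "c \<le> h (z + \<epsilon> *\<^sub>R (v - t *\<^sub>R u))" for w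
      proof (rule ccontr)
        assume "\<not> a w + t * b w < 0"
        then have nn: "0 \<le> a w + t * b w" by simp
        have "b w / (D + (a w + t * b w)) < \<epsilon>"
          using convex_ray_test(1)[OF hc(1,2) \<epsilon>(1) crossing[OF h that(2) nn]] that(4) hc(3) by simp
        moreover have "\<epsilon> \<le> b w / (D + (a w + t * b w))" 
          using that(1,3) nn by (intro \<epsilon>(2)) (auto simp: F_def)
        ultimately show False by simp
      qed
      moreover have "a w + t * b w < 0" if "w \<in> S" "h w \<le> 0" "b w < 0" "h (z + \<epsilon> *\<^sub>R (v - t *\<^sub>R u)) < c" for w
      proof (rule ccontr)
        assume "\<not> a w + t * b w < 0"
        then have nn: "0 \<le> a w + t * b w" by simp
        have "0 < b w / (D + (a w + t * b w))"
          using convex_ray_test(2)[OF hc(1,2) \<epsilon>(1) crossing[OF h that(2) nn]] that(4) hc(3) by simp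
        moreover have "b w / (D + (a w + t * b w)) < 0" using that(3) nn D by (simp add: divide_neg_pos)
        ultimately show False by simp
      qed
      ultimately show ?thesis by (simp add: A_def B_def)
    qed
    then show "\<exists>y \<tau>. \<forall>h\<in>H. if \<tau> \<le> h y then A h t else B h t" by blast
  next
    fix H' l r
    assume H': "H' \<subseteq> H" and "l < r" and gap: "T \<inter> {l<..<r} = {}" 
      and AB: "\<And>h. h \<in> H' \<Longrightarrow> A h l \<and> B h r"
    define t where "t = (l + r) / 2"
    have t: "l < t" "t < r" using \<open>l < r\<close> by (auto simp: t_def)
    have "a w + t * b w < 0" if "h \<in> H'" "w \<in> S" "h w \<le> 0" for h w
    proof -
      consider "0 < b w" | "b w < 0" | "b w = 0" by linarith
      then show ?thesis
      proof cases
        case 1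
        then have "l < - a w / b w" using AB[OF that(1)] that pos by (auto simp: A_def)
        then have "r \<le> - a w / b w" using gap T[of w] that(2) 1 by force
        then show ?thesis using t pos[OF 1] by simp
      next
        case 2
        then have "- a w / b w < r" using AB[OF that(1)] that neg by (auto simp: B_def)
        then have "- a w / b w \<le> l" using gap T[of w] that(2) 2 by force
        then show ?thesis using t neg[OF 2] by simp
      next
        \<comment> \<open>Now \<open>w\<close> is on the line through \<open>x\<close> and \<open>z\<close>. If it were beyond \<open>z\<close>, then \<open>z\<close> would be
          between two points with nonpositive value.\<close>
        case 3
        then show ?thesis 
          using crossing[of h w 0] H(1)[of h] H(2) that H' by fastforce
      qed
    qed
    then have "(u + t *\<^sub>R v) \<bullet> w < (u + t *\<^sub>R v) \<bullet> z" if "h \<in> H'" "w \<in> S" "h w \<le> 0" for h w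
      using that by (simp add: a_def b_def inner_diff_right inner_add_left algebra_simps)
    then show "solvable P H' n" by (rule after_cut[OF H'])
  qed
qed

section \<open>Shrinking the candidate set\<close>

text \<open>Each of the \<open>j\<close> phases costs one query at the centerpoint and at most \<open>k\<close> for the cut, and
  multiplies the number of candidates by at most \<open>3 / 4\<close>.\<close>
lemma solvable_lattice_set:
  fixes x :: point and P :: "point set"
  assumes P: "P \<subseteq> lattice"
    and S: "finite S" "S \<subseteq> P" "midpoint_closed S" "card S < 2 ^ k" "real (card S) < (4 / 3) ^ j"
    and H: "\<And>h. h \<in> H \<Longrightarrow> convex_on UNIV h \<and> h x \<le> 0 \<and> {w\<in>P. h w \<le> 0} \<subseteq> S"
  shows "solvable P H (j * Suc k)"
  using S H
proof (induction j arbitrary: S H)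
  case 0
  then show ?case by (intro solvable.answer[of _ _ None]) (auto simp: correct_answer_def)
next
  case (Suc j)
  show ?case
  proof (cases "S = {}")
    case True
    with Suc.prems(6) show ?thesis 
      by (intro solvable.answer[of _ _ None]) (auto simp: correct_answer_def)
  next
    case False
    obtain z where z: "z \<in> S" "\<And>s. card S \<le> 2 ^ CARD(2) * card {w\<in>S. s \<bullet> z \<le> s \<bullet> w}"
      using lattice_centerpoint[OF Suc.prems(1) False _ Suc.prems(3)] Suc.prems(2) P by blast
    have "solvable P {h\<in>H. h z = c} (k + j * Suc k)" for c
    proof (cases "c \<le> 0")
      case True
      then show ?thesis using z(1) Suc.prems(2)
        by (intro solvable.answer[of _ _ "Some z"]) (auto simp: correct_answer_def)
    next
      case False
      show ?thesis
      proof (rule solvable_by_halfplane_cut[OF Suc.prems(1,4), of _ x z c])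
        show "convex_on UNIV h \<and> h x \<le> 0 \<and> h z = c" if "h \<in> {h\<in>H. h z = c}" for h
          using that Suc.prems(6) by auto
        show "0 < c" using False by simp
      next
        fix H' s
        assume H': "H' \<subseteq> {h\<in>H. h z = c}"
          and cut: "\<And>h w. h \<in> H' \<Longrightarrow> w \<in> S \<Longrightarrow> h w \<le> 0 \<Longrightarrow> s \<bullet> w < s \<bullet> z"
        let ?S = "{w\<in>S. s \<bullet> w < s \<bullet> z}"
        let ?R = "{w\<in>S. s \<bullet> z \<le> s \<bullet> w}"
        have "card ?S + card ?R = card (?S \<union> ?R)"
          using Suc.prems(1) by (intro card_Un_disjoint[symmetric]) auto
        also have "?S \<union> ?R = S" by auto
        finally have "card ?S + card ?R = card S" .
        then have "4 * card ?S \<le> 3 * card S" using z(2)[of s] by simp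
        then have "real (card ?S) \<le> 3 / 4 * card S" by linarith
        also have "\<dots> < 3 / 4 * (4 / 3) ^ Suc j" using Suc.prems(5) by simp
        finally have small: "real (card ?S) < (4 / 3) ^ j" by simp
        show "solvable P H' (j * Suc k)"
        proof (rule Suc.IH)
          show "card ?S < 2 ^ k"
            using Suc.prems(1,4) card_mono[of S ?S] by auto
          show "convex_on UNIV h \<and> h x \<le> 0 \<and> {w\<in>P. h w \<le> 0} \<subseteq> ?S" if "h \<in> H'" for h
            using Suc.prems(6)[of h] H' cut[of h] that by blast
        qed (use Suc.prems small midpoint_closed_halfspace in auto)
      qed
    qed
    then have "solvable P H (Suc (k + j * Suc k))" by (rule solvable.query)
    then show ?thesis by (simp add: ac_simps)
  qed
qed

section \<open>From query complexity to algorithms\<close>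

text \<open>The parameter \<open>c\<close> stands for the value of \<open>f\<close> at the given point, which an algorithm knows only
  after evaluating it.\<close>
primrec violation :: "nat \<Rightarrow> (point \<Rightarrow> real) \<Rightarrow> (nat \<Rightarrow> point \<Rightarrow> real) \<Rightarrow> real \<Rightarrow> point \<Rightarrow> real" where
  "violation 0 f g c y = f y - c"
| "violation (Suc m) f g c y = max (g (Suc m) y) (violation m f g c y)"

lemma violation_nonpos_iff: "violation m f g c y \<le> 0 \<longleftrightarrow> f y \<le> c \<and> (\<forall>i\<in>{1..m}. g i y \<le> 0)"
proof (induction m)
  case (Suc m)
  have "{1..Suc m} = insert (Suc m) {1..m}" by auto
  with Suc show ?case by auto
qed simp

lemma convex_on_max:
  assumes "convex_on A f" "convex_on A g"
  shows "convex_on A (\<lambda>x. max (f x) (g x))"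
proof (rule convex_onI)
  fix t :: real and x y
  assume t: "0 < t" "t < 1" and xy: "x \<in> A" "y \<in> A"
  have "f ((1 - t) *\<^sub>R x + t *\<^sub>R y) \<le> (1 - t) * f x + t * f y"
    by (rule convex_onD[OF assms(1)]) (use t xy in auto)
  also have "\<dots> \<le> (1 - t) * max (f x) (g x) + t * max (f y) (g y)"
    using t by (intro add_mono mult_left_mono) auto
  finally have 1: "f ((1 - t) *\<^sub>R x + t *\<^sub>R y) \<le> \<dots>" .
  have "g ((1 - t) *\<^sub>R x + t *\<^sub>R y) \<le> (1 - t) * g x + t * g y"
    by (rule convex_onD[OF assms(2)]) (use t xy in auto)
  also have "\<dots> \<le> (1 - t) * max (f x) (g x) + t * max (f y) (g y)"
    using t by (intro add_mono mult_left_mono) auto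
  finally show "max (f ((1 - t) *\<^sub>R x + t *\<^sub>R y)) (g ((1 - t) *\<^sub>R x + t *\<^sub>R y)) \<le> \<dots>"
    using 1 by simp
qed (use assms convex_on_imp_convex in auto)

lemma convex_on_violation:
  assumes "convex_on UNIV f" "\<forall>i\<in>{1..m}. convex_on UNIV (g i)"
  shows "convex_on UNIV (violation m f g c)"
  using assms(2)
proof (induction m)
  case 0
  have "convex_on UNIV (\<lambda>y. f y + (- c))"
    using assms(1) by (intro convex_on_add) (simp_all add: convex_on_const)
  then show ?case by simp
next
  case (Suc m)
  then have "convex_on UNIV (\<lambda>y. max (g (Suc m) y) (violation m f g c y))"
    by (intro convex_on_max) auto
  then show ?case by simp
qed

primrec sweep :: "nat \<Rightarrow> func list" where
  "sweep 0 = [Objective]"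
| "sweep (Suc m) = Constraint (Suc m) # sweep m"

lemma set_sweep: "set (sweep m) = {Objective} \<union> Constraint ` {1..m}"
  by (induction m) (auto simp: atLeastAtMostSuc_conv)

lemma distinct_sweep: "distinct (sweep m)"
  by (induction m) (auto simp: set_sweep)

primrec evaluate_violation :: "nat \<Rightarrow> real \<Rightarrow> point \<Rightarrow> (real \<Rightarrow> algorithm) \<Rightarrow> algorithm" where
  "evaluate_violation 0 c y k = Evaluate Objective y (\<lambda>v. k (v - c))"
| "evaluate_violation (Suc m) c y k =
     Evaluate (Constraint (Suc m)) y (\<lambda>v. evaluate_violation m c y (\<lambda>u. k (max v u)))"

lemma run_evaluate_violation:
  "result (interp f g) (evaluate_violation m c y k) =
     result (interp f g) (k (violation m f g c y))"
  "evaluations (interp f g) (evaluate_violation m c y k) =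
     sweep m @ evaluations (interp f g) (k (violation m f g c y))"
  by (induction m arbitrary: k) auto

text \<open>The evaluations form complete sweeps, so that the number of queries bounds the number of
  evaluations of each single function, independently of \<open>m\<close>.\<close>
lemma algorithm_of_solvable:
  assumes "solvable P H n"
  shows "\<exists>A. \<forall>f g. violation m f g c \<in> H \<longrightarrow>
    correct_answer P (violation m f g c) (result (interp f g) A) \<and>
    (\<exists>k\<le>n. evaluations (interp f g) A = concat (replicate k (sweep m)))"
  using assms
proof induction
  case (answer H r n)
  then show ?case by (intro exI[of _ "Return r"]) auto
next
  case (query H y n)
  then obtain A where A: "\<And>v f g. violation m f g c \<in> H \<Longrightarrow> violation m f g c y = v \<Longrightarrow>
      correct_answer P (violation m f g c) (result (interp f g) (A v)) \<and>
      (\<exists>k\<le>n. evaluations (interp f g) (A v) = concat (replicate k (sweep m)))"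
    by simp metis
  show ?case
  proof (intro exI[of _ "evaluate_violation m c y A"] allI impI conjI)
    fix f g assume fg: "violation m f g c \<in> H"
    then show "correct_answer P (violation m f g c) (result (interp f g) (evaluate_violation m c y A))"
      using A by (simp add: run_evaluate_violation)
    obtain k where "k \<le> n" 
      "evaluations (interp f g) (A (violation m f g c y)) = concat (replicate k (sweep m))"
      using A[OF fg] by blast
    then show "\<exists>k\<le>Suc n. evaluations (interp f g) (evaluate_violation m c y A) 
        = concat (replicate k (sweep m))"
      by (intro exI[of _ "Suc k"]) (simp add: run_evaluate_violation)
  qed
qed

lemma count_list_concat_replicate:
  "count_list (concat (replicate k xs)) q = k * count_list xs q"
  by (induction k) auto

lemma count_list_distinct_le_one: "distinct xs \<Longrightarrow> count_list xs q \<le> 1"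
  by (induction xs) (auto simp: count_list_0_iff)

section \<open>Integer points of a square\<close>
lemma integer_points_eq_lattice: "integer_points = lattice"
  by (simp add: integer_points_def lattice_def)

lemma midpoint_closed_square: "midpoint_closed (square B \<inter> integer_points)"
proof -
  have "midpoint a b \<in> square B" if "a \<in> square B" "b \<in> square B" for a b
  proof -
    have "- real B \<le> a $ j" "a $ j \<le> real B" "- real B \<le> b $ j" "b $ j \<le> real B" for j
      using that by (auto simp: square_def)
    then have "- real B \<le> (a $ j + b $ j) / 2" "(a $ j + b $ j) / 2 \<le> real B" for j
      using add_mono[of "- real B" "a $ j" "- real B" "b $ j"]
        add_mono[of "a $ j" "real B" "b $ j" "real B"] by simp_all
    then show ?thesis by (simp add: square_def midpoint_def)
  qed
  then show ?thesis by (auto simp: midpoint_closed_def integer_points_eq_lattice)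
qed

lemma card_square:
  "finite (square B \<inter> integer_points)" "card (square B \<inter> integer_points) \<le> (2 * B + 1) ^ 2"
proof -
  let ?I = "{- int B..int B}"
  let ?F = "\<lambda>(i, j). vector [real_of_int i, real_of_int j] :: point"
  have sub: "square B \<inter> integer_points \<subseteq> ?F ` (?I \<times> ?I)"
  proof
    fix y assume y: "y \<in> square B \<inter> integer_points"
    then have "y $ 1 \<in> \<int>" "y $ 2 \<in> \<int>" by (auto simp: integer_points_def)
    then obtain i j where ij: "y $ 1 = of_int i" "y $ 2 = of_int j"
      by (auto elim!: Ints_cases)
    have "- real B \<le> y $ k" "y $ k \<le> real B" for k using y by (auto simp: square_def)
    from this[of 1] this[of 2] have "(i, j) \<in> ?I \<times> ?I" unfolding ij by auto
    moreover have "y = ?F (i, j)" by (simp add: vec_eq_iff forall_2 ij)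
    ultimately show "y \<in> ?F ` (?I \<times> ?I)" by blast
  qed
  then show "finite (square B \<inter> integer_points)" by (rule finite_subset) simp
  have "card (square B \<inter> integer_points) \<le> card (?F ` (?I \<times> ?I))"
    using sub by (intro card_mono) auto
  also have "\<dots> \<le> card (?I \<times> ?I)" by (intro card_image_le) simp
  also have "\<dots> = (2 * B + 1) ^ 2" 
  proof -
    have "card ?I = 2 * B + 1" by (simp add: nat_add_distrib nat_mult_distrib)
    then show ?thesis by (simp only: card_cartesian_product power2_eq_square)
  qed
  finally show "card (square B \<inter> integer_points) \<le> (2 * B + 1) ^ 2" .
qed

text \<open>Since \<open>ln (4 / 3) \<ge> 1 / 4\<close>, the factor 8 yields \<open>exp (2 * ln B) = B\<^sup>2\<close>, and the summand 16 yields
  \<open>exp 4\<close>, more than the constant 9 in \<open>(2 * B + 1)\<^sup>2 \<le> 9 * B\<^sup>2\<close>.\<close>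
lemma square_lt_power:
  assumes "1 \<le> B" "8 * ln (real B) + 16 \<le> real j"
  shows "real ((2 * B + 1) ^ 2) < (4 / 3) ^ j"
proof -
  have B: "1 \<le> real B" using assms(1) by simp
  have "1 - inverse (4 / 3) \<le> ln (4 / 3 :: real)"
    using ln_le_minus_one[of "3/4::real"] ln_inverse[of "4/3::real"]
    by simp
  then have ln: "1 / 4 \<le> ln (4 / 3 :: real)" by simp
  have "real ((2 * B + 1) ^ 2) = (2 * real B + 1)\<^sup>2" by simp
  also have "\<dots> \<le> (3 * real B)\<^sup>2" using B by (intro power_mono) auto
  also have "\<dots> < 16 * (real B)\<^sup>2" using B by (simp add: power_mult_distrib)
  also have "\<dots> \<le> exp 4 * (real B)\<^sup>2"
  proof -
    have "(2::real) ^ 4 \<le> exp 1 ^ 4" using exp_ge_add_one_self[of "1::real"] by (intro power_mono) auto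
    also have "exp 1 ^ 4 = exp (4::real)" by (simp flip: exp_of_nat_mult)
    finally show ?thesis by (intro mult_right_mono) auto
  qed
  also have "\<dots> = exp (4 + 2 * ln (real B))" 
    using B by (simp add: exp_add exp_double)
  also have "\<dots> \<le> exp (real j * ln (4 / 3))"
    using assms(2) mult_left_mono[OF ln, of "real j"] by simp
  also have "\<dots> = (4 / 3) ^ j" by (simp add: exp_of_nat_mult)
  finally show ?thesis .
qed

section \<open>The polynomial bound\<close>

definition phases :: "nat \<Rightarrow> nat" where
  "phases B = nat \<lceil>8 * ln (real B)\<rceil> + 16"

lemma solvable_improving_points:
  fixes x :: point
  assumes "1 \<le> B"
  shows "solvable (square B \<inter> integer_points) {h. convex_on UNIV h \<and> h x \<le> 0}
    (phases B * Suc (phases B))"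
proof (rule solvable_lattice_set)
  let ?P = "square B \<inter> integer_points"
  have "8 * ln (real B) + 16 \<le> real (phases B)" unfolding phases_def by linarith
  then have small: "real (card ?P) < (4 / 3) ^ phases B"
    using square_lt_power[OF assms] card_square(2)[of B] by (meson le_less_trans of_nat_mono)
  also have "\<dots> \<le> 2 ^ phases B" by (intro power_mono) auto
  finally show "card ?P < 2 ^ phases B" by (metis of_nat_less_iff of_nat_numeral of_nat_power)
  show "real (card ?P) < (4 / 3) ^ phases B" by (rule small)
qed (auto simp: integer_points_eq_lattice[symmetric] card_square midpoint_closed_square)

theorem theorem2:
  shows "\<exists>(p :: real poly) (A :: nat \<Rightarrow> nat \<Rightarrow> point \<Rightarrow> algorithm).
    \<forall>(m :: nat) (f :: point \<Rightarrow> real) (g :: nat \<Rightarrow> point \<Rightarrow> real) (B :: nat) (x :: point).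
      convex_on UNIV f \<longrightarrow> (\<forall>i\<in>{1..m}. convex_on UNIV (g i)) \<longrightarrow>
      B \<ge> 1 \<longrightarrow> x \<in> square B \<longrightarrow> (\<forall>i\<in>{1..m}. g i x \<le> 0) \<longrightarrow>
      set (evaluations (interp f g) (A m B x)) \<subseteq> {Objective} \<union> Constraint ` {1..m} \<and>
      (\<forall>q \<in> {Objective} \<union> Constraint ` {1..m}.
         real (count_list (evaluations (interp f g) (A m B x)) q) \<le> poly p (ln (real B))) \<and>
      (case result (interp f g) (A m B x) of
         Some y \<Rightarrow> y \<in> improving_points m f g B x
       | None \<Rightarrow> improving_points m f g B x = {})"
proof -
  define n where "n B = phases B * Suc (phases B)" for B
  define H where "H x = {h. convex_on UNIV h \<and> h x \<le> 0}" for x :: point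
  define solves where "solves m B x c A \<longleftrightarrow> (\<forall>f g. violation m f g c \<in> H x \<longrightarrow>
      correct_answer (square B \<inter> integer_points) (violation m f g c) (result (interp f g) A) \<and>
      (\<exists>k\<le>n B. evaluations (interp f g) A = concat (replicate k (sweep m))))" for m B x c A
  define C where "C m B x c = (SOME A. solves m B x c A)" for m B x c
  have C: "solves m B x c (C m B x c)" if "1 \<le> B" for m B x c
  proof -
    have "\<exists>A. solves m B x c A" unfolding solves_def n_def H_def
      by (rule algorithm_of_solvable[OF solvable_improving_points[OF that]])
    then show ?thesis unfolding C_def by (rule someI_ex)
  qed
  define A where "A m B x = Evaluate Objective x (C m B x)" for m B x
  \<comment> \<open>Rounding up gives \<open>phases B \<le> 8 * ln B + 17\<close>; the constant 1 pays for the evaluation of \<open>f\<close> at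
    \<open>x\<close>.\<close>
  define p :: "real poly" where "p = [:17, 8:] * [:18, 8:] + 1"
  have p: "1 + real (n B) \<le> poly p (ln (real B))" if "1 \<le> B" for B
  proof -
    have "real (phases B) \<le> 17 + 8 * ln (real B)"
      using that ln_ge_zero[of "real B"] unfolding phases_def by linarith
    then have "real (phases B) * real (Suc (phases B)) \<le> (17 + 8 * ln (real B)) * (18 + 8 * ln (real B))"
      using that by (intro mult_mono) auto
    then show ?thesis by (simp add: p_def n_def algebra_simps)
  qed
  have "set (evaluations (interp f g) (A m B x)) \<subseteq> {Objective} \<union> Constraint ` {1..m} \<and>
      (\<forall>q \<in> {Objective} \<union> Constraint ` {1..m}.
         real (count_list (evaluations (interp f g) (A m B x)) q) \<le> poly p (ln (real B))) \<and>
      (case result (interp f g) (A m B x) of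
         Some y \<Rightarrow> y \<in> improving_points m f g B x
       | None \<Rightarrow> improving_points m f g B x = {})"
    if fg: "convex_on UNIV f" "\<forall>i\<in>{1..m}. convex_on UNIV (g i)" and B: "B \<ge> 1" 
      and x: "\<forall>i\<in>{1..m}. g i x \<le> 0" for m f g B x
  proof -
    have "violation m f g (f x) \<in> H x"
      using convex_on_violation[OF fg] x by (simp add: H_def violation_nonpos_iff)
    with C[OF B] have sound: "correct_answer (square B \<inter> integer_points) (violation m f g (f x))
        (result (interp f g) (A m B x))"
      and "\<exists>k\<le>n B. evaluations (interp f g) (A m B x) = Objective # concat (replicate k (sweep m))"
      by (simp_all add: solves_def A_def)
    then obtain k where k: "k \<le> n B" 
      "evaluations (interp f g) (A m B x) = Objective # concat (replicate k (sweep m))"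
      by blast
    have "set (evaluations (interp f g) (A m B x)) \<subseteq> {Objective} \<union> Constraint ` {1..m}"
      unfolding k(2) using set_sweep[of m] by auto
    moreover have "real (count_list (evaluations (interp f g) (A m B x)) q) \<le> poly p (ln (real B))" for q
    proof -
      have "count_list (evaluations (interp f g) (A m B x)) q \<le> 1 + k * count_list (sweep m) q"
        unfolding k(2) by (simp add: count_list_concat_replicate)
      also have "\<dots> \<le> 1 + n B * 1"
        using k(1) count_list_distinct_le_one[OF distinct_sweep] by (intro add_mono mult_mono) auto
      finally show ?thesis using p[OF B] by simp
    qed
    moreover have "case result (interp f g) (A m B x) of
         Some y \<Rightarrow> y \<in> improving_points m f g B x
       | None \<Rightarrow> improving_points m f g B x = {}"
      using sound by (auto simp: correct_answer_def improving_points_def violation_nonpos_iff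
          split: option.splits)
    ultimately show ?thesis by blast
  qed
  then show ?thesis by blast
qed

end
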